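(* Let $d,\tilde d\in\mathbb{R}^m$ with $d,\tilde d>0$ and $\ell,\tilde\ell\in\mathbb{R}^m$ with $f(d,\ell)>0$ and $f(\tilde d,\tilde\ell)>0$. Let $j\in\{1,\dots,m\}$ and suppose $$\frac{1}{f(\tilde d,\tilde\ell)}\tilde d=\alpha\Big(\frac{1}{f(d,\ell)}d+\frac{2}{m-1}\frac{1}{\gamma_j(d,\ell)^2}e_j\Big)$$ for some scalar $\alpha\ge\frac{m^2-1}{m^2}$. Then $\mathrm{vol}\,E(\tilde d,\tilde\ell)\le e^{-\frac{1}{2(m+1)}}\mathrm{vol}\,E(d,\ell)$.
   Context: Standing assumption: $A=[a_1|\cdots|a_m]\in\mathbb{R}^{n\times m}$ has columns of unit Euclidean norm and $\{A\lambda:\lambda\ge0\}=\mathbb{R}^n$ (so $m>n\ge1$); $u\in\mathbb{R}^m$. $D=\mathrm{diag}(d)$; $r(\ell)=\tfrac12(u+\ell)$, $v(\ell)=\tfrac12(u-\ell)$, $B(d)=ADA^\top$, $y(d,\ell)=B(d)^{-1}ADr(\ell)$, $t(d,\ell)=A^\top y(d,\ell)-r(\ell)$, $f(d,\ell)=v(\ell)^\top Dv(\ell)-t(d,\ell)^\top Dt(d,\ell)$, $\gamma_i(d,\ell)=\sqrt{f(d,\ell)a_i^\top B(d)^{-1}a_i}$. $E(d,\ell)=\{x:(A^\top x-\ell)^\top D(A^\top x-u)\le0\}$, and its (relative) volume is defined as $\mathrm{vol}\,E(d,\ell):=f(d,\ell)^{n/2}/\sqrt{\det(ADA^\top)}$.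 *)

theory Defs
  imports "HOL-Analysis.Analysis"
begin

text \<open>Setting: A is an n x m real matrix (n = CARD('n), m = CARD('m)), columns a_i = column i A.\<close>

definition diagm :: "real^'m \<Rightarrow> real^'m^'m" where
  "diagm d = (\<chi> i k. if i = k then d $ i else 0)"

definition rr :: "real^'m \<Rightarrow> real^'m \<Rightarrow> real^'m" where
  "rr u l = (1/2) *\<^sub>R (u + l)"

definition vv :: "real^'m \<Rightarrow> real^'m \<Rightarrow> real^'m" where
  "vv u l = (1/2) *\<^sub>R (u - l)"

definition BB :: "real^'m^'n \<Rightarrow> real^'m \<Rightarrow> real^'n^'n" where
  "BB A d = A ** diagm d ** transpose A"

definition yy :: "real^'m^'n \<Rightarrow> real^'m \<Rightarrow> real^'m \<Rightarrow> real^'m \<Rightarrow> real^'n" where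
  "yy A u d l = matrix_inv (BB A d) *v (A *v (diagm d *v rr u l))"

definition tt :: "real^'m^'n \<Rightarrow> real^'m \<Rightarrow> real^'m \<Rightarrow> real^'m \<Rightarrow> real^'m" where
  "tt A u d l = transpose A *v yy A u d l - rr u l"

definition ff :: "real^'m^'n \<Rightarrow> real^'m \<Rightarrow> real^'m \<Rightarrow> real^'m \<Rightarrow> real" where
  "ff A u d l = vv u l \<bullet> (diagm d *v vv u l) - tt A u d l \<bullet> (diagm d *v tt A u d l)"

definition gam :: "real^'m^'n \<Rightarrow> real^'m \<Rightarrow> real^'m \<Rightarrow> real^'m \<Rightarrow> 'm \<Rightarrow> real" where
  "gam A u d l i = sqrt (ff A u d l * (column i A \<bullet> (matrix_inv (BB A d) *v column i A)))"

definition ellE :: "real^'m^'n \<Rightarrow> real^'m \<Rightarrow> real^'m \<Rightarrow> real^'m \<Rightarrow> (real^'n) set" where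
  "ellE A u d l = {x. (transpose A *v x - l) \<bullet> (diagm d *v (transpose A *v x - u)) \<le> 0}"

text \<open>Relative volume of E(d,l).\<close>
definition volE :: "real^'m^'n \<Rightarrow> real^'m \<Rightarrow> real^'m \<Rightarrow> real^'m \<Rightarrow> real" where
  "volE A u d l = ff A u d l powr (real CARD('n) / 2) / sqrt (det (BB A d))"

end

theory Submission
  imports Defs
begin

text \<open>Write \<open>f = f(d,\<ell>)\<close>, \<open>f' = f(d',\<ell>')\<close> and \<open>a = a\<^sub>j\<close>. The update makes \<open>d'\<close> a positive
  multiple \<open>s = \<alpha> f'/f\<close> of \<open>d + t e\<^sub>j\<close>, so \<open>B(d') = s (B(d) + t a a\<^sup>T)\<close>. Since
  \<open>\<gamma>\<^sub>j\<^sup>2 = f a\<^sup>T B(d)\<^sup>-\<^sup>1 a\<close>, the matrix determinant lemma gives \<open>det B(d') = s\<^sup>n det B(d) (m+1)/(m-1)\<close>,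
  so the volume shrinks by the factor \<open>\<alpha>\<^sup>-\<^sup>n\<^sup>/\<^sup>2 ((m-1)/(m+1))\<^sup>1\<^sup>/\<^sup>2\<close>. The cone condition forces
  \<open>m \<ge> 2\<close> and \<open>n \<le> m\<close>, and with \<open>\<alpha> \<ge> 1 - 1/m\<^sup>2\<close> the claim becomes an elementary inequality in \<open>m\<close>.\<close>

lemma matrix_vector_mul_matrix_inv_cancel:
  fixes M :: "real^'n^'n"
  assumes "invertible M"
  shows "M *v (matrix_inv M *v x) = x"
proof -
  have "\<exists>M'. M ** M' = mat 1 \<and> M' ** M = mat 1"
    using assms by (simp add: invertible_def)
  then have "M ** matrix_inv M = mat 1"
    unfolding matrix_inv_def by (rule someI2_ex) blast
  then show ?thesis by (simp add: matrix_vector_mul_assoc)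
qed

lemma det_rows_add_row_multiples:
  fixes Q :: "'a::comm_ring_1^'n^'n"
  assumes "finite S" "k \<notin> S"
  shows "det (\<chi> i. if i \<in> S then row i Q + c i *s row k Q else row i Q) = det Q"
  using assms
proof (induction S rule: finite_induct)
  case empty
  then show ?case by (simp add: row_def vec_lambda_eta)
next
  case (insert s S)
  define Q' where "Q' = (\<chi> i. if i \<in> S then row i Q + c i *s row k Q else row i Q)"
  have "s \<noteq> k" using insert by auto
  have "(\<chi> i. if i \<in> insert s S then row i Q + c i *s row k Q else row i Q)
     = (\<chi> i. if i = s then row s Q' + c s *s row k Q' else row i Q')"
    using insert by (auto simp: Q'_def row_def vec_eq_iff)
  also have "det \<dots> = det Q'" by (rule det_row_operation[OF \<open>s \<noteq> k\<close>])
  also have "\<dots> = det Q" using insert Q'_def by simp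
  finally show ?case .
qed

lemma det_add_rank_one_rows:
  fixes M :: "'a::comm_ring_1^'n^'n"
  assumes "finite S"
  shows "det (\<chi> i. if i \<in> S then row i M + u$i *s w else row i M)
       = det M + (\<Sum>i\<in>S. u$i * det (\<chi> r. if r = i then w else row r M))"
  using assms
proof (induction S rule: finite_induct)
  case empty
  then show ?case by (simp add: row_def vec_lambda_eta)
next
  case (insert k S)
  define X where "X = (\<lambda>i. if i \<in> S then row i M + u$i *s w else row i M)"
  define Q where "Q = (\<chi> r. if r = k then w else row r M)"
  have "det (\<chi> i. if i \<in> insert k S then row i M + u$i *s w else row i M)
     = det (\<chi> i. if i = k then row k M + u$k *s w else X i)"
    using insert by (intro arg_cong[where f=det]) (auto simp: X_def vec_eq_iff)
  also have "\<dots> = det (\<chi> i. if i = k then row k M else X i) + u$k * det (\<chi> i. if i = k then w else X i)"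
    by (simp add: det_row_add det_row_mul)
  also have "det (\<chi> i. if i = k then row k M else X i) = det (\<chi> i. if i \<in> S then row i M + u$i *s w else row i M)"
    using insert by (intro arg_cong[where f=det]) (auto simp: X_def vec_eq_iff)
  also have "(\<chi> i. if i = k then w else X i) = (\<chi> i. if i \<in> S then row i Q + u$i *s row k Q else row i Q)"
    using insert by (auto simp: X_def Q_def row_def vec_eq_iff)
  also have "det \<dots> = det Q"
    using insert by (intro det_rows_add_row_multiples) auto
  finally show ?case using insert by (simp add: Q_def algebra_simps)
qed

text \<open>The matrix determinant lemma \<open>det (M + u w\<^sup>T) = det M (1 + u\<^sup>T M\<^sup>-\<^sup>T w)\<close>.\<close>
lemma det_add_rank_one:
  fixes M :: "real^'n^'n"
  assumes "invertible M"
  shows "det (\<chi> i. row i M + u$i *s w) = det M * (1 + u \<bullet> (matrix_inv (transpose M) *v w))"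
proof -
  define x where "x = matrix_inv (transpose M) *v w"
  have "invertible (transpose M)"
    using assms by (simp add: invertible_det_nz)
  then have "transpose M *v x = w"
    unfolding x_def by (rule matrix_vector_mul_matrix_inv_cancel)
  then have w: "w = (\<Sum>i\<in>UNIV. x$i *s row i M)"
    by (simp only: matrix_mult_sum column_transpose)
  have "det (\<chi> i. row i M + u$i *s w) = det (\<chi> i. if i \<in> UNIV then row i M + u$i *s w else row i M)"
    by simp
  also have "\<dots> = det M + (\<Sum>i\<in>UNIV. u$i * det (\<chi> r. if r = i then w else row r M))"
    by (rule det_add_rank_one_rows) simp
  also have "\<dots> = det M + (\<Sum>i\<in>UNIV. u$i * (x$i * det M))"
    unfolding w by (subst cramer_lemma_transpose) simp
  also have "\<dots> = det M * (1 + u \<bullet> x)"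
    by (simp add: inner_vec_def sum_distrib_left sum_distrib_right algebra_simps)
  finally show ?thesis unfolding x_def .
qed

lemma det_scaleR: "det (c *\<^sub>R (X::real^'n^'n)) = c ^ CARD('n) * det X"
proof -
  have "c *\<^sub>R X = (\<chi> i. c *s row i X)" "(\<chi> i. row i X) = X"
    by (simp_all add: vec_eq_iff row_def)
  then show ?thesis using det_rows_mul[of "\<lambda>i. c" "\<lambda>i. row i X"] by simp
qed

lemma pos_def_det_nonzero:
  fixes M :: "real^'n^'n"
  assumes "\<And>x. x \<noteq> 0 \<Longrightarrow> x \<bullet> (M *v x) > 0"
  shows "det M \<noteq> 0"
proof -
  have "inj ((*v) M)"
  proof (rule injI)
    fix x y assume "M *v x = M *v y"
    then have "M *v (x - y) = 0" by (simp add: matrix_vector_mult_diff_distrib)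
    then show "x = y" using assms[of "x - y"] by (cases "x - y = 0") auto
  qed
  then show ?thesis using det_nz_iff_inj[of "(*v) M"] by (simp add: matrix_of_matrix_vector_mul)
qed

text \<open>The segment from \<open>M\<close> to the identity stays positive definite, so \<open>det\<close> cannot change sign along it.\<close>
lemma pos_def_det_pos:
  fixes M :: "real^'n^'n"
  assumes pd: "\<And>x. x \<noteq> 0 \<Longrightarrow> x \<bullet> (M *v x) > 0"
  shows "det M > 0"
proof (rule ccontr)
  assume "\<not> det M > 0"
  define F where "F = (\<lambda>t::real. t *\<^sub>R mat 1 + (1 - t) *\<^sub>R M)"
  have "continuous_on {0..1} (\<lambda>t. det (F t))"
    unfolding det_def F_def by (intro continuous_intros)
  moreover have "det (F 0) \<le> 0" "0 \<le> det (F 1)"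
    using \<open>\<not> det M > 0\<close> by (auto simp: F_def)
  ultimately obtain t where t: "0 \<le> t" "t \<le> 1" "det (F t) = 0"
    using IVT'[of "\<lambda>t. det (F t)" 0 0 1] by auto
  have "det (F t) \<noteq> 0"
  proof (rule pos_def_det_nonzero)
    fix x :: "real^'n" assume "x \<noteq> 0"
    have "x \<bullet> (F t *v x) = t * (x \<bullet> x) + (1 - t) * (x \<bullet> (M *v x))"
      by (simp add: F_def matrix_vector_mult_add_rdistrib scaleR_matrix_vector_assoc[symmetric]
          inner_add_right)
    moreover have "x \<bullet> x > 0" "x \<bullet> (M *v x) > 0" using pd \<open>x \<noteq> 0\<close> by auto
    ultimately show "x \<bullet> (F t *v x) > 0" using t
      by (smt (verit) mult_nonneg_nonneg mult_pos_pos)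
  qed
  then show False using t by simp
qed

lemma two_div_le_ln_ratio:
  fixes m :: real
  assumes "m > 1"
  shows "2 / m \<le> ln ((m + 1) / (m - 1))"
proof -
  define g where "g = (\<lambda>t::real. ln (1 + t) - ln (1 - t) - 2 * t)"
  have "g 0 \<le> g (1/m)"
  proof (rule DERIV_nonneg_imp_nondecreasing[of 0 "1/m" g])
    show "0 \<le> 1/m" using assms by simp
    fix t assume t: "0 \<le> t" "t \<le> 1/m"
    then have "t < 1" using assms by (smt (verit) divide_less_eq_1_pos)
    have "(g has_real_derivative (1/(1+t) + 1/(1-t) - 2)) (at t)"
      unfolding g_def using t \<open>t < 1\<close> by (auto intro!: derivative_eq_intros)
    moreover have "1/(1+t) + 1/(1-t) = 2 / (1 - t^2)"
      using t \<open>t < 1\<close> by (simp add: field_simps power2_eq_square)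
    moreover have "0 < 1 - t^2" "1 - t^2 \<le> 1"
      using t \<open>t < 1\<close> by (simp_all add: abs_square_less_1)
    ultimately show "\<exists>y. (g has_real_derivative y) (at t) \<and> 0 \<le> y"
      by (auto simp: le_divide_eq)
  qed
  moreover have "1 + 1/m = (m+1)/m" "1 - 1/m = (m-1)/m"
    using assms by (auto simp: field_simps)
  ultimately show ?thesis
    using assms by (simp add: g_def ln_div)
qed

text \<open>With \<open>\<alpha> \<ge> 1 - 1/m\<^sup>2\<close> and \<open>n \<le> m\<close>, the logarithm of the right-hand side is at least
  \<open>(m/2) ln (1 - 1/m\<^sup>2) + ln ((m+1)/(m-1))/2 \<ge> -m/(2(m\<^sup>2-1)) + 1/m\<close>, which exceeds \<open>1/(2(m+1))\<close>
  by \<open>(m-2)/(2m(m\<^sup>2-1)) \<ge> 0\<close>.\<close>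
lemma volume_ratio_bound:
  fixes m n \<alpha> :: real
  assumes m: "m \<ge> 2" and n: "0 \<le> n" "n \<le> m" and \<alpha>: "\<alpha> \<ge> (m^2 - 1) / m^2"
  shows "exp (1 / (2 * (m + 1))) \<le> \<alpha> powr (n/2) * sqrt ((m + 1) / (m - 1))"
proof -
  define q where "q = (m^2 - 1) / m^2"
  have "2*2 \<le> m * m" using m by (intro mult_mono) auto
  then have m21: "m^2 - 1 > 0" by (simp add: power2_eq_square)
  have q: "0 < q" "q \<le> 1" using m21 m by (simp_all add: q_def)
  have "q powr (m/2) \<le> q powr (n/2)"
    using q n by (intro powr_mono') auto
  also have "\<dots> \<le> \<alpha> powr (n/2)"
    using q \<alpha> n by (intro powr_mono2) (auto simp: q_def)
  finally have q_\<alpha>: "q powr (m/2) \<le> \<alpha> powr (n/2)" .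
  have "ln (1/q) \<le> 1/q - 1" using q by (intro ln_le_minus_one) simp
  also have "1/q - 1 = 1 / (m^2 - 1)"
    using m21 unfolding q_def by (simp add: divide_simps)
  finally have "ln q \<ge> - 1 / (m^2 - 1)" using q by (simp add: ln_div)
  then have "(m/2) * ln q \<ge> (m/2) * (- 1 / (m^2 - 1))"
    using m by (intro mult_left_mono) auto
  moreover have "2 / m \<le> ln ((m + 1) / (m - 1))"
    using m by (intro two_div_le_ln_ratio) simp
  moreover have "1 / (2 * (m + 1)) \<le> (m/2) * (- 1 / (m^2 - 1)) + 1 / m"
  proof -
    have "m^2 - 1 = (m - 1) * (m + 1)" by (simp add: power2_eq_square algebra_simps)
    then have "(m/2) * (- 1 / (m^2 - 1)) + 1 / m - 1 / (2 * (m + 1)) = (m - 2) / (2 * m * (m^2 - 1))"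
      using m by (simp add: divide_simps) (simp add: algebra_simps)
    also have "\<dots> \<ge> 0" using m m21 by simp
    finally show ?thesis by simp
  qed
  ultimately have "1 / (2 * (m + 1)) \<le> (m/2) * ln q + ln ((m + 1) / (m - 1)) / 2"
    by linarith
  then have "exp (1 / (2 * (m + 1))) \<le> exp ((m/2) * ln q) * exp (ln ((m + 1) / (m - 1)) / 2)"
    by (simp flip: exp_add)
  also have "\<dots> = q powr (m/2) * sqrt ((m + 1) / (m - 1))"
    using q m by (simp add: powr_def powr_half_sqrt[symmetric] mult.commute)
  also have "\<dots> \<le> \<alpha> powr (n/2) * sqrt ((m + 1) / (m - 1))"
    using q_\<alpha> m by (intro mult_right_mono) auto
  finally show ?thesis .
qed

lemma BB_entry: "BB A d $ i $ k = (\<Sum>l\<in>UNIV. A$i$l * d$l * A$k$l)"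
  by (simp add: BB_def diagm_def matrix_matrix_mult_def transpose_def if_distrib sum.delta'
      cong: if_cong)

lemma BB_transpose: "transpose (BB A d) = BB A d"
  by (simp add: vec_eq_iff BB_entry transpose_def mult.commute mult.left_commute)

lemma BB_scaleR: "BB A (c *\<^sub>R d) = c *\<^sub>R BB A d"
  by (simp add: vec_eq_iff BB_entry sum_distrib_left ac_simps)

lemma BB_add_axis:
  "BB A (d + t *\<^sub>R axis j 1) = (\<chi> i. row i (BB A d) + (t * column j A $ i) *s column j A)"
proof -
  have "(\<Sum>l\<in>UNIV. A$i$l * (t * axis j 1 $ l) * A$k$l) = t * A$i$j * A$k$j" for i k
    by (simp add: axis_def if_distrib if_distribR cong: if_cong)
  then have "BB A (d + t *\<^sub>R axis j 1) $ i $ k = BB A d $ i $ k + t * A$i$j * A$k$j" for i k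
    by (simp add: BB_entry distrib_left distrib_right sum.distrib)
  then show ?thesis by (simp add: vec_eq_iff row_def column_def)
qed

lemma BB_quadratic_form: "x \<bullet> (BB A d *v x) = (\<Sum>l\<in>UNIV. d$l * ((transpose A *v x)$l)^2)"
proof -
  define y where "y = transpose A *v x"
  have "x \<bullet> (BB A d *v x) = x \<bullet> (A *v (diagm d *v y))"
    unfolding BB_def y_def by (simp only: matrix_vector_mul_assoc matrix_mul_assoc)
  also have "\<dots> = y \<bullet> (diagm d *v y)"
    by (simp add: dot_lmul_matrix[symmetric] y_def)
  also have "(diagm d *v y) $ i = d$i * y$i" for i
    by (simp add: diagm_def matrix_vector_mult_def if_distrib[where f="\<lambda>z. z * _"] sum.delta
        cong: if_cong)
  then have "y \<bullet> (diagm d *v y) = (\<Sum>l\<in>UNIV. d$l * (y$l)^2)"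
    by (simp add: inner_vec_def power2_eq_square ac_simps)
  finally show ?thesis by (simp add: y_def)
qed

lemma BB_pos_def:
  fixes A :: "real^'m^'n"
  assumes "surj ((*v) A)" "\<forall>i. d$i > 0" "x \<noteq> 0"
  shows "x \<bullet> (BB A d *v x) > 0"
proof -
  obtain lam where "x = A *v lam" using \<open>surj ((*v) A)\<close> by (metis surjD)
  then have "x \<bullet> x = (transpose A *v x) \<bullet> lam"
    by (simp add: dot_lmul_matrix)
  then obtain k where k: "(transpose A *v x) $ k \<noteq> 0"
    using \<open>x \<noteq> 0\<close> by (metis inner_eq_zero_iff inner_zero_left vec_eq_iff zero_index)
  have "0 < d$k * ((transpose A *v x) $ k)^2" using k assms(2) by simp
  also have "\<dots> \<le> (\<Sum>l\<in>UNIV. d$l * ((transpose A *v x)$l)^2)"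
    by (rule member_le_sum) (use assms(2) in \<open>auto intro!: mult_nonneg_nonneg simp: less_imp_le\<close>)
  finally show ?thesis by (simp add: BB_quadratic_form)
qed

lemma det_BB_pos:
  fixes A :: "real^'m^'n"
  assumes "surj ((*v) A)" "\<forall>i. d$i > 0"
  shows "det (BB A d) > 0"
  using BB_pos_def[OF assms] by (rule pos_def_det_pos)

lemma column_inner_matrix_inv_BB_pos:
  fixes A :: "real^'m^'n"
  assumes "surj ((*v) A)" "\<forall>i. d$i > 0" "column j A \<noteq> 0"
  shows "column j A \<bullet> (matrix_inv (BB A d) *v column j A) > 0"
proof -
  define z where "z = matrix_inv (BB A d) *v column j A"
  have "invertible (BB A d)"
    using det_BB_pos[OF assms(1,2)] by (simp add: invertible_det_nz)
  then have "BB A d *v z = column j A"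
    unfolding z_def by (rule matrix_vector_mul_matrix_inv_cancel)
  with \<open>column j A \<noteq> 0\<close> have "z \<noteq> 0" by auto
  then have "z \<bullet> (BB A d *v z) > 0" by (rule BB_pos_def[OF assms(1,2)])
  then have "z \<bullet> column j A > 0" by (simp only: \<open>BB A d *v z = column j A\<close>)
  then show ?thesis by (simp add: z_def inner_commute)
qed

lemma det_BB_add_axis:
  assumes "invertible (BB A d)"
  shows "det (BB A (d + t *\<^sub>R axis j 1))
       = det (BB A d) * (1 + t * (column j A \<bullet> (matrix_inv (BB A d) *v column j A)))"
  using det_add_rank_one[OF assms, of "t *\<^sub>R column j A" "column j A"]
  by (simp add: BB_add_axis BB_transpose)

lemma card_ge_2_if_conic_hull_UNIV:
  fixes A :: "real^'m^'n"
  assumes "{A *v lam | lam. \<forall>i. lam $ i \<ge> 0} = UNIV"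
  shows "CARD('m) \<ge> 2"
proof (rule ccontr)
  assume "\<not> CARD('m) \<ge> 2"
  moreover have "CARD('m) > 0" by simp
  ultimately have "CARD('m) = 1" by linarith
  then obtain j :: 'm where UNIV_j: "UNIV = {j}"
    by (metis card_1_singletonE)
  have cone: "A *v lam = lam$j *\<^sub>R column j A" for lam
    by (simp add: vec_eq_iff matrix_vector_mult_def column_def UNIV_j mult.commute)
  define x :: "real^'n" where "x = axis undefined 1"
  have "x \<in> {A *v lam | lam. \<forall>i. lam $ i \<ge> 0}" "-x \<in> {A *v lam | lam. \<forall>i. lam $ i \<ge> 0}"
    using assms by simp_all
  then obtain lam\<^sub>1 lam\<^sub>2 where "x = A *v lam\<^sub>1" "-x = A *v lam\<^sub>2" "lam\<^sub>1$j \<ge> 0" "lam\<^sub>2$j \<ge> 0"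
    by blast
  then have "A *v lam\<^sub>1 + A *v lam\<^sub>2 = 0"
    by (metis add.right_inverse)
  then have "(lam\<^sub>1$j + lam\<^sub>2$j) *\<^sub>R column j A = 0"
    by (simp add: cone scaleR_add_left)
  then have "x = 0"
    using \<open>x = A *v lam\<^sub>1\<close> \<open>lam\<^sub>1$j \<ge> 0\<close> \<open>lam\<^sub>2$j \<ge> 0\<close> by (auto simp: cone)
  then show False by (simp add: x_def)
qed

lemma card_le_if_surj_matrix_vector_mult:
  fixes A :: "real^'m^'n"
  assumes "surj ((*v) A)"
  shows "CARD('n) \<le> CARD('m)"
  using full_rank_surjective[of A] rank_bound[of A] assms by simp

lemma det_BB_update:
  fixes A :: "real^'m^'n"
  assumes "f > 0" "f' > 0" "invertible (BB A d)"
    and upd: "(1 / f') *\<^sub>R d' = \<alpha> *\<^sub>R ((1 / f) *\<^sub>R d + t *\<^sub>R axis j 1)"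
  shows "det (BB A d') = (f' * \<alpha> / f) ^ CARD('n)
           * (det (BB A d) * (1 + f * t * (column j A \<bullet> (matrix_inv (BB A d) *v column j A))))"
proof -
  have "d' = f' *\<^sub>R ((1 / f') *\<^sub>R d')" using \<open>f' > 0\<close> by simp
  also have "\<dots> = f' *\<^sub>R (\<alpha> *\<^sub>R ((1 / f) *\<^sub>R d + t *\<^sub>R axis j 1))"
    by (simp only: upd)
  also have "\<dots> = (f' * \<alpha> / f) *\<^sub>R (d + (f * t) *\<^sub>R axis j 1)"
    using \<open>f > 0\<close> by (simp add: vec_eq_iff field_simps)
  finally show ?thesis
    using det_BB_add_axis[OF assms(3), of "f * t" j] by (simp add: BB_scaleR det_scaleR)
qed

lemma volE_update:
  fixes A :: "real^'m^'n"
  assumes f: "ff A u d l > 0" "ff A u d' l' > 0" and "\<alpha> > 0" "det (BB A d) > 0" "K > 0"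
    and det: "det (BB A d') = (ff A u d' l' * \<alpha> / ff A u d l) ^ CARD('n) * (det (BB A d) * K)"
  shows "volE A u d' l' = volE A u d l / (\<alpha> powr (real CARD('n) / 2) * sqrt K)"
proof -
  define s where "s = ff A u d' l' * \<alpha> / ff A u d l"
  define p where "p = real CARD('n) / 2"
  have "s > 0" using assms by (simp add: s_def)
  then have "sqrt (s ^ CARD('n)) = s powr p"
    by (simp add: p_def powr_half_sqrt_powr powr_realpow)
  also have "\<dots> = ff A u d' l' powr p * \<alpha> powr p / ff A u d l powr p"
    using assms by (simp add: s_def powr_mult powr_divide)
  finally have sqrt_det: "sqrt (det (BB A d'))
      = ff A u d' l' powr p * \<alpha> powr p / ff A u d l powr p * sqrt (det (BB A d)) * sqrt K"
    unfolding det[folded s_def] by (simp add: real_sqrt_mult)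
  show ?thesis
    using f \<open>\<alpha> > 0\<close> \<open>det (BB A d) > 0\<close> \<open>K > 0\<close>
    unfolding volE_def p_def[symmetric] sqrt_det by (simp add: field_simps)
qed

theorem lemma10:
  fixes A :: "real^'m^'n" and u d d' l l' :: "real^'m" and j :: 'm and \<alpha> :: real
  assumes unit_cols: "\<forall>i. norm (column i A) = 1"
    and cone: "{A *v lam | lam. \<forall>i. lam $ i \<ge> 0} = UNIV"
    and dpos: "\<forall>i. d $ i > 0" and d'pos: "\<forall>i. d' $ i > 0"
    and fpos: "ff A u d l > 0" and f'pos: "ff A u d' l' > 0"
    and upd: "(1 / ff A u d' l') *\<^sub>R d' =
       \<alpha> *\<^sub>R ((1 / ff A u d l) *\<^sub>R d
          + ((2 / (real CARD('m) - 1)) * (1 / (gam A u d l j)\<^sup>2)) *\<^sub>R axis j (1::real))"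
    and alpha: "\<alpha> \<ge> (real CARD('m) ^ 2 - 1) / real CARD('m) ^ 2"
  shows "volE A u d' l' \<le> exp (- 1 / (2 * (real CARD('m) + 1))) * volE A u d l"
proof -
  define a where "a = column j A"
  define K where "K = (real CARD('m) + 1) / (real CARD('m) - 1)"
  have "y \<in> {A *v lam | lam. \<forall>i. lam $ i \<ge> 0}" for y using cone by simp
  then have surj: "surj ((*v) A)" unfolding surj_def by blast
  have m: "real CARD('m) \<ge> 2" using card_ge_2_if_conic_hull_UNIV[OF cone] by simp
  have detB: "det (BB A d) > 0" by (rule det_BB_pos[OF surj dpos])
  have "a \<noteq> 0" using unit_cols by (metis a_def norm_zero zero_neq_one)
  then have aBa: "a \<bullet> (matrix_inv (BB A d) *v a) > 0"
    unfolding a_def by (rule column_inner_matrix_inv_BB_pos[OF surj dpos])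
  then have "(gam A u d l j)\<^sup>2 = ff A u d l * (a \<bullet> (matrix_inv (BB A d) *v a))"
    using fpos by (simp add: gam_def a_def)
  then have K: "1 + ff A u d l * ((2 / (real CARD('m) - 1)) * (1 / (gam A u d l j)\<^sup>2))
      * (a \<bullet> (matrix_inv (BB A d) *v a)) = K"
    using m fpos aBa by (simp add: K_def field_simps)
  have "real CARD('m) ^ 2 > 1" using m by (simp add: one_less_power)
  then have "\<alpha> > 0" using alpha by (smt (verit) divide_pos_pos)
  have "K > 0" using m by (simp add: K_def)
  have bound: "exp (1 / (2 * (real CARD('m) + 1))) \<le> \<alpha> powr (real CARD('n) / 2) * sqrt K"
    unfolding K_def using volume_ratio_bound[OF m _ _ alpha] card_le_if_surj_matrix_vector_mult[OF surj]
    by simp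
  have "invertible (BB A d)" using detB by (simp add: invertible_det_nz)
  from det_BB_update[OF fpos f'pos this upd, folded a_def, unfolded K]
  have "volE A u d' l' = volE A u d l / (\<alpha> powr (real CARD('n) / 2) * sqrt K)"
    using \<open>\<alpha> > 0\<close> \<open>K > 0\<close> fpos f'pos detB by (intro volE_update)
  also have "\<dots> \<le> volE A u d l / exp (1 / (2 * (real CARD('m) + 1)))"
    using bound fpos detB \<open>\<alpha> > 0\<close> \<open>K > 0\<close> by (intro divide_left_mono) (auto simp: volE_def)
  also have "\<dots> = exp (- 1 / (2 * (real CARD('m) + 1))) * volE A u d l"
    by (simp add: exp_minus field_simps)
  finally show ?thesis .
qed

end
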